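(* For all integers $n\ge 0$ and $k\ge 1$, $$p^k_n=\sum_{s=0}^{n}\binom{n}{s}\,p^0_s\,k^{n-s}.$$
   Context: A preferential arrangement of a finite set $S$ is an ordered set partition of $S$ (a sequence of nonempty pairwise disjoint blocks with union $S$); the empty set has exactly one. Let $a(w)$ be the number of preferential arrangements of a $w$-element set ($a(0)=1$). A barred preferential arrangement of $X_n=\{1,\dots,n\}$ with $k$ bars is a sequence of $k+1$ possibly empty, pairwise disjoint sections with union $X_n$, each equipped with a preferential arrangement of its elements. A restricted section is one whose preferential arrangement has at most one block; a free section may carry any preferential arrangement. For $k\ge0$, $p^k_n$ is the number of barred preferential arrangements of $X_n$ with $k$ bars in which one fixed section is free and the other $k$ sections are restricted; equivalently $p^k_n=\sum_{w_1+\cdots+w_{k+1}=n}\frac{n!}{w_1!\cdots w_{k+1}!}a(w_{1})$ (sum over nonnegative integer solutions). In particular $p^0_n=a(n)$. *)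

theory Defs
  imports Main "HOL-Library.Disjoint_Sets"
begin

definition pref_arrangements :: "'a set \<Rightarrow> 'a set list set" where
  "pref_arrangements S = {bs. distinct bs \<and> partition_on S (set bs)}"

text \<open>A section is stored as its list of blocks. Its set of elements is the union of the
  blocks, so an empty section is the empty list.\<close>

definition section_elems :: "'a set list \<Rightarrow> 'a set" where
  "section_elems bs = \<Union> (set bs)"

text \<open>With \<open>k\<close> bars there are \<open>k + 1\<close> sections, at positions \<open>0, \<dots>, k\<close>.\<close>

definition barred_pref_arrangements :: "nat \<Rightarrow> 'a set \<Rightarrow> 'a set list list set" where
  "barred_pref_arrangements k S =
    {xs. length xs = k + 1 \<and>
         disjoint_family_on (\<lambda>i. section_elems (xs ! i)) {..k} \<and>
         (\<Union>i\<le>k. section_elems (xs ! i)) = S \<and>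
         (\<forall>i\<le>k. xs ! i \<in> pref_arrangements (section_elems (xs ! i)))}"

definition restricted_section :: "'a set list \<Rightarrow> bool" where
  "restricted_section bs \<longleftrightarrow> length bs \<le> 1"

text \<open>The fixed free section is the first one, at position \<open>0\<close>.\<close>

definition one_free_count :: "nat \<Rightarrow> nat \<Rightarrow> nat" where
  "one_free_count k n =
    card {xs \<in> barred_pref_arrangements k {1..n}. \<forall>i\<in>{1..k}. restricted_section (xs ! i)}"

end

theory Submission
  imports Defs "HOL-Library.FuncSet"
begin

text \<open>A restricted section is determined by its set of elements. So a barred preferential
  arrangement with one free section amounts to a set \<open>A\<close> of elements for the free section, a
  preferential arrangement of \<open>A\<close>, and a function from the remaining elements to the \<open>k\<close>
  restricted sections; there are \<open>k\<close> to the power \<open>n - card A\<close> such functions.\<close>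

lemma section_elems_pref_arrangements:
  "bs \<in> pref_arrangements S \<Longrightarrow> section_elems bs = S"
  by (auto simp: pref_arrangements_def section_elems_def partition_on_def)

lemma finite_pref_arrangements:
  assumes "finite S" shows "finite (pref_arrangements S)"
proof (rule finite_subset)
  show "pref_arrangements S \<subseteq> {bs. set bs \<subseteq> Pow S \<and> distinct bs}"
    by (auto simp: pref_arrangements_def partition_on_def)
  show "finite {bs. set bs \<subseteq> Pow S \<and> distinct bs}"
    using assms by (intro finite_subset_distinct) auto
qed

text \<open>All blocks lie in \<open>Pow A\<close>, where taking images under \<open>f\<close> is
  injective because \<open>f\<close> is injective on \<open>A\<close>. Hence distinct blocks keep
  distinct images.\<close>

lemma map_image_pref_arrangements:
  assumes bs: "bs \<in> pref_arrangements A" and f: "inj_on f A"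
  shows "map ((`) f) bs \<in> pref_arrangements (f ` A)"
proof -
  have p: "partition_on A (set bs)" and d: "distinct bs"
    using bs by (auto simp: pref_arrangements_def)
  have "set bs \<subseteq> Pow A" using p by (auto simp: partition_on_def)
  then have "inj_on ((`) f) (set bs)"
    using inj_on_image_Pow[OF f] by (rule inj_on_subset[rotated])
  moreover have "{} \<notin> (`) f ` set bs"
    using p by (auto simp: partition_on_def)
  ultimately show ?thesis
    using partition_on_inj_image[OF p f] d
    by (simp add: pref_arrangements_def distinct_map)
qed

text \<open>Relabelling along \<open>f\<close> is undone by relabelling along its inverse. So the
  number of arrangements depends only on the size of the set, which later allows subsets to be
  grouped by cardinality.\<close>

lemma card_pref_arrangements_eq:
  assumes f: "bij_betw f A B"
  shows "card (pref_arrangements A) = card (pref_arrangements B)"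
proof -
  \<comment> \<open>Kept polymorphic, so that it serves for \<open>f\<close> followed by
    \<open>?g\<close> and for \<open>?g\<close> followed by \<open>f\<close>.\<close>
  have map_inv: "map ((`) h) (map ((`) g) bs) = bs"
    if "bs \<in> pref_arrangements C" "\<And>x. x \<in> C \<Longrightarrow> h (g x) = x"
    for bs :: "'c set list" and C and g :: "'c \<Rightarrow> 'd" and h
    unfolding map_map
  proof (rule map_idI)
    fix T assume "T \<in> set bs"
    then have "T \<subseteq> C" using that(1) by (auto simp: pref_arrangements_def partition_on_def)
    then show "((`) h \<circ> (`) g) T = T"
      using that(2) by (force simp: image_image)
  qed
  let ?g = "inv_into A f"
  have g: "bij_betw ?g B A" using f by (rule bij_betw_inv_into)
  have "bij_betw (map ((`) f)) (pref_arrangements A) (pref_arrangements B)"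
  proof (rule bij_betw_byWitness[where f' = "map ((`) ?g)"])
    show "\<forall>bs\<in>pref_arrangements A. map ((`) ?g) (map ((`) f) bs) = bs"
      using f by (intro ballI map_inv) (auto simp: bij_betw_inv_into_left)
    show "\<forall>bs\<in>pref_arrangements B. map ((`) f) (map ((`) ?g) bs) = bs"
      using f by (intro ballI map_inv) (auto simp: bij_betw_inv_into_right)
    show "map ((`) f) ` pref_arrangements A \<subseteq> pref_arrangements B"
      using map_image_pref_arrangements[of _ A f] f by (auto simp: bij_betw_def)
    show "map ((`) ?g) ` pref_arrangements B \<subseteq> pref_arrangements A"
      using map_image_pref_arrangements[of _ B ?g] g by (auto simp: bij_betw_def)
  qed
  then show ?thesis by (rule bij_betw_same_card)
qed

text \<open>The case split is forced: blocks are nonempty, so the empty set is arranged by the empty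
  list and not by \<open>[{}]\<close>.\<close>

definition block_section :: "'a set \<Rightarrow> 'a set list" where
  "block_section T = (if T = {} then [] else [T])"

lemma section_elems_block_section [simp]: "section_elems (block_section T) = T"
  by (simp add: section_elems_def block_section_def)

lemma block_section_pref_arrangements: "block_section T \<in> pref_arrangements T"
  by (simp add: pref_arrangements_def block_section_def partition_on_def)

lemma restricted_block_section: "restricted_section (block_section T)"
  by (simp add: restricted_section_def block_section_def)

lemma restricted_section_eq_block_section:
  assumes "bs \<in> pref_arrangements S" "restricted_section bs"
  shows "bs = block_section S"
  using assms
  by (cases bs) (auto simp: pref_arrangements_def restricted_section_def block_section_def
      partition_on_def)

lemma card_barred_pref_arrangements_one_free:
  fixes S :: "'a set"
  assumes S: "finite S"
  shows "card {xs \<in> barred_pref_arrangements k S. \<forall>i\<in>{1..k}. restricted_section (xs ! i)} =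
    (\<Sum>A\<in>Pow S. card (pref_arrangements A) * k ^ (card S - card A))"
    (is "card ?Y = _")
proof -
  \<comment> \<open>The third component sends each element outside the free section to the position
    of its restricted section. Extensionality makes this function unique.\<close>
  define X where "X = (SIGMA A:Pow S. pref_arrangements A \<times> ((S - A) \<rightarrow>\<^sub>E {1..k}))"
  define enc where "enc = (\<lambda>(A, bs, f).
      bs # map (\<lambda>i. block_section {x \<in> S - A. f x = i}) [1..<Suc k])"
  \<comment> \<open>The description \<open>THE\<close> is meaningful on \<open>?Y\<close>, where the
    sections are disjoint and cover \<open>S\<close>. The restriction to the complement of the free
    section yields an extensional function.\<close>
  define dec where "dec xs = (section_elems (xs ! 0), xs ! 0,
      \<lambda>x\<in>S - section_elems (xs ! 0). THE i. i \<in> {1..k} \<and> x \<in> section_elems (xs ! i))"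
    for xs :: "'a set list list"
  have enc_nth: "enc (A, bs, f) ! i =
      (if i = 0 then bs else block_section {x \<in> S - A. f x = i})" if "i \<le> k" for A bs f i
    using that by (cases i) (auto simp: enc_def nth_append simp del: upt_Suc)
  have len_enc: "length (enc p) = k + 1" for p
    by (simp add: enc_def split: prod.split)
  have "bij_betw enc X ?Y"
  proof (rule bij_betw_byWitness[where f' = dec])
    show "\<forall>p\<in>X. dec (enc p) = p"
    proof (clarify, goal_cases)
      case (1 A bs f)
      then have bs: "section_elems bs = A" and f: "f \<in> (S - A) \<rightarrow>\<^sub>E {1..k}"
        by (auto simp: X_def section_elems_pref_arrangements)
      have "(THE i. i \<in> {1..k} \<and> x \<in> section_elems (enc (A, bs, f) ! i)) = f x"
        if "x \<in> S - A" for x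
      proof -
        have "f x \<in> {1..k}" using f that by auto
        then show ?thesis
          using that by (intro the_equality) (auto simp: enc_nth)
      qed
      \<comment> \<open>Outside \<open>S - A\<close> both sides are
        \<open>undefined\<close>.\<close>
      then have "(\<lambda>x\<in>S - A. THE i. i \<in> {1..k} \<and> x \<in> section_elems (enc (A, bs, f) ! i)) = f"
        using f by (intro ext) (auto simp: restrict_def PiE_def extensional_def)
      then show ?case by (simp add: dec_def enc_nth bs)
    qed
    show "enc ` X \<subseteq> ?Y"
    proof (rule image_subsetI)
      fix p assume "p \<in> X"
      then obtain A bs f where p: "p = (A, bs, f)" and A: "A \<subseteq> S"
        and bs: "bs \<in> pref_arrangements A" and f: "f \<in> (S - A) \<rightarrow>\<^sub>E {1..k}"
        by (auto simp: X_def)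
      note elems = section_elems_pref_arrangements[OF bs]
      have el: "section_elems (enc (A, bs, f) ! i) = (if i = 0 then A else {x \<in> S - A. f x = i})"
        if "i \<le> k" for i
        using that by (simp add: enc_nth elems)
      have "(\<Union>i\<le>k. section_elems (enc (A, bs, f) ! i)) =
          (\<Union>i\<le>k. if i = 0 then A else {x \<in> S - A. f x = i})"
        by (intro SUP_cong) (auto simp: el)
      \<comment> \<open>An element of \<open>A\<close> is covered at position 0, any other
        \<open>x\<close> at position \<open>f x\<close>.\<close>
      also have "\<dots> = S"
      proof
        show "(\<Union>i\<le>k. if i = 0 then A else {x \<in> S - A. f x = i}) \<subseteq> S"
          using A by (auto split: if_splits)
        show "S \<subseteq> (\<Union>i\<le>k. if i = 0 then A else {x \<in> S - A. f x = i})"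
        proof
          fix x assume x: "x \<in> S"
          show "x \<in> (\<Union>i\<le>k. if i = 0 then A else {x \<in> S - A. f x = i})"
          proof (cases "x \<in> A")
            case True then show ?thesis by (intro UN_I[of 0]) auto
          next
            case False
            then have "f x \<in> {1..k}" using f x by auto
            then show ?thesis using False x by (intro UN_I[of "f x"]) auto
          qed
        qed
      qed
      finally show "enc p \<in> ?Y"
        using bs by (auto simp: p barred_pref_arrangements_def len_enc el elems disjoint_family_on_def
            enc_nth block_section_pref_arrangements restricted_block_section)
    qed
    show "\<forall>xs\<in>?Y. enc (dec xs) = xs" and "dec ` ?Y \<subseteq> X"
    proof -
      have "enc (dec xs) = xs \<and> dec xs \<in> X" if xs: "xs \<in> ?Y" for xs
      proof -
        define A where "A = section_elems (xs ! 0)"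
        define f where "f = (\<lambda>x\<in>S - A. THE i. i \<in> {1..k} \<and> x \<in> section_elems (xs ! i))"
        have dec: "dec xs = (A, xs ! 0, f)" by (simp add: dec_def A_def f_def)
        have len: "length xs = k + 1"
          and disj: "disjoint_family_on (\<lambda>i. section_elems (xs ! i)) {..k}"
          and un: "(\<Union>i\<le>k. section_elems (xs ! i)) = S"
          and pref: "\<And>i. i \<le> k \<Longrightarrow> xs ! i \<in> pref_arrangements (section_elems (xs ! i))"
          and res: "\<And>i. i \<in> {1..k} \<Longrightarrow> restricted_section (xs ! i)"
          using xs by (auto simp: barred_pref_arrangements_def)
        \<comment> \<open>Position 0 is included, so this also separates the free section from the
          restricted ones.\<close>
        have uniq: "i = j" if "i \<le> k" "j \<le> k" "x \<in> section_elems (xs ! i)"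
          "x \<in> section_elems (xs ! j)" for i j x
          using disj that unfolding disjoint_family_on_def by blast
        have A: "A \<subseteq> S" using un by (auto simp: A_def)
        have f: "f x = i" if "i \<in> {1..k}" "x \<in> section_elems (xs ! i)" for x i
        proof -
          have "x \<in> S - A" using that un uniq[of i 0 x] by (auto simp: A_def)
          then show ?thesis
            using that uniq by (auto simp: f_def intro!: the_equality)
        qed
        have ex: "\<exists>i\<in>{1..k}. x \<in> section_elems (xs ! i)" if x: "x \<in> S - A" for x
        proof -
          obtain i where i: "i \<le> k" "x \<in> section_elems (xs ! i)" using x un by blast
          then have "i \<noteq> 0" using x by (auto simp: A_def intro: gr0I)
          then show ?thesis using i by auto
        qed
        \<comment> \<open>The fibres of the decoded function are the element sets of the restricted
          sections, and these determine the sections.\<close>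
        have fibre: "{x \<in> S - A. f x = i} = section_elems (xs ! i)" if i: "i \<in> {1..k}" for i
        proof
          show "{x \<in> S - A. f x = i} \<subseteq> section_elems (xs ! i)" using ex f by fastforce
          show "section_elems (xs ! i) \<subseteq> {x \<in> S - A. f x = i}"
            using i f un uniq[of i 0] by (auto simp: A_def)
        qed
        have "f \<in> (S - A) \<rightarrow>\<^sub>E {1..k}"
        proof (rule PiE_I)
          show "f x \<in> {1..k}" if "x \<in> S - A" for x using ex[OF that] f by auto
        qed (auto simp: f_def)
        then have "dec xs \<in> X" using A pref[of 0] by (simp add: dec X_def A_def)
        moreover have "enc (dec xs) = xs"
        proof (rule nth_equalityI)
          fix i assume "i < length (enc (dec xs))"
          then have "i \<le> k" by (simp add: len_enc)
          then show "enc (dec xs) ! i = xs ! i"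
            using fibre[of i] restricted_section_eq_block_section[OF pref res, of i]
            by (cases "i = 0") (simp_all add: dec enc_nth)
        qed (simp add: len_enc len)
        ultimately show ?thesis by blast
      qed
      then show "\<forall>xs\<in>?Y. enc (dec xs) = xs" "dec ` ?Y \<subseteq> X" by blast+
    qed
  qed
  then have "card ?Y = card X" by (simp add: bij_betw_same_card)
  also have "\<dots> = (\<Sum>A\<in>Pow S. card (pref_arrangements A \<times> ((S - A) \<rightarrow>\<^sub>E {1..k})))"
    unfolding X_def using S
    by (intro card_SigmaI)
      (auto intro!: finite_cartesian_product finite_PiE finite_pref_arrangements
        intro: finite_subset)
  also have "\<dots> = (\<Sum>A\<in>Pow S. card (pref_arrangements A) * k ^ (card S - card A))"
    using S by (intro sum.cong)
      (auto simp: card_cartesian_product card_PiE card_Diff_subset finite_subset)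
  finally show ?thesis .
qed

text \<open>Without restricted sections the free one must take everything. In the sum over
  \<open>A\<close> this appears as \<open>0 ^ (n - card A)\<close>, which vanishes for proper
  subsets and is \<open>0 ^ 0 = 1\<close> for the whole set.\<close>

lemma one_free_count_0: "one_free_count 0 n = card (pref_arrangements {1..n})"
proof -
  have "one_free_count 0 n =
      (\<Sum>A\<in>Pow {1..n}. card (pref_arrangements A) * 0 ^ (n - card A))"
    unfolding one_free_count_def by (subst card_barred_pref_arrangements_one_free) simp_all
  also have "\<dots> = (\<Sum>A\<in>{{1..n}}. card (pref_arrangements A) * 0 ^ (n - card A))"
  proof (rule sum.mono_neutral_right)
    show "\<forall>A\<in>Pow {1..n} - {{1..n}}. card (pref_arrangements A) * 0 ^ (n - card A) = 0"
      using psubset_card_mono[of "{1..n}"] by (auto simp: psubset_eq)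
  qed auto
  finally show ?thesis by simp
qed

theorem theorem4:
  fixes n k :: nat
  assumes "k \<ge> 1"
  shows "one_free_count k n = (\<Sum>s=0..n. (n choose s) * one_free_count 0 s * k ^ (n - s))"
proof -
  \<comment> \<open>\<open>A\<close> is relabelled to the initial segment of its size, where
    \<open>one_free_count_0\<close> applies.\<close>
  have pref: "card (pref_arrangements A) = one_free_count 0 (card A)" if "A \<subseteq> {1..n}" for A
  proof -
    have "finite A" using that by (rule finite_subset) simp
    then obtain h where "bij_betw h A {1..card A}"
      using finite_same_card_bij[of A "{1..card A}"] by auto
    then show ?thesis unfolding one_free_count_0 by (rule card_pref_arrangements_eq)
  qed
  have "one_free_count k n =
      (\<Sum>A\<in>Pow {1..n}. card (pref_arrangements A) * k ^ (n - card A))"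
    unfolding one_free_count_def by (subst card_barred_pref_arrangements_one_free) simp_all
  also have "\<dots> = (\<Sum>A\<in>Pow {1..n}. one_free_count 0 (card A) * k ^ (n - card A))"
    by (intro sum.cong) (auto simp: pref)
  \<comment> \<open>The subsets are grouped by their size \<open>s\<close>. The summand is constant
    on each group, and the group has \<open>n choose s\<close> members.\<close>
  also have "\<dots> = (\<Sum>s\<in>{0..n}. \<Sum>A | A \<in> Pow {1..n} \<and> card A = s.
      one_free_count 0 (card A) * k ^ (n - card A))"
    using card_mono[of "{1..n}"] by (intro sum.group[symmetric]) auto
  also have "\<dots> = (\<Sum>s=0..n. (n choose s) * one_free_count 0 s * k ^ (n - s))"
    using n_subsets[of "{1..n}"] by (intro sum.cong) (auto simp: mult.assoc)
  finally show ?thesis .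
qed

end
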